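(* Let $m\geq 3$, $n\geq 2$, and let $G$ be a connected graph of QE class on $l$ vertices. Then $$\mathrm{QEC}(K_{m,n}\times G)=l\,\frac{n(m-2)+m(n-2)}{m+n}.$$ In particular, $\mathrm{QEC}(K_{m,n}\times T)=l\,\frac{n(m-2)+m(n-2)}{m+n}$ for any tree $T$ on $l$ vertices.
   Context: All graphs are finite, simple and unweighted (undirected). $K_{m,n}$ is the complete bipartite graph with parts of sizes $m$ and $n$. For a connected graph $G=(V,E)$, $D_G$ is its distance matrix (entries are shortest-path distances), and the quadratic embedding constant is $\mathrm{QEC}(G):=\max\{\langle f,D_Gf\rangle : f\in\mathbb{R}^{V},\ \langle f,f\rangle=1,\ \langle e,f\rangle=0\}$, where $e$ is the all-ones vector and $\langle\cdot,\cdot\rangle$ the standard inner product. A connected graph $G=(V,E)$ is of QE class if there is a map $\psi:V\to\mathcal{H}$ into a Euclidean space with $d(i,j)=\|\psi(i)-\psi(j)\|^2$ for all $i,j\in V$, where $d$ is the graph distance; by Schoenberg's theorem this is equivalent to $\mathrm{QEC}(G)\le 0$. The Cartesian product $G_1\times G_2$ of $G_1=(V_1,E_1)$ and $G_2=(V_2,E_2)$ has vertex set $V_1\times V_2$, with $(u,v)$ and $(u',v')$ adjacent iff either $u\sim u'$ in $G_1$ and $v=v'$, or $u=u'$ and $v\sim v'$ in $G_2$. *)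

theory Defs
  imports "HOL-Analysis.L2_Norm" "Graph_Theory.Graph_Theory"
begin

text \<open>
  A finite simple undirected graph is a \<^const>\<open>pair_graph\<close>: a finite, loop-free, symmetric
  digraph without parallel arcs, each undirected edge being represented by its two orientations.
\<close>

definition connected_graph :: "'a pair_pre_digraph \<Rightarrow> bool" where
  "connected_graph G \<longleftrightarrow> pair_graph G \<and> Digraph_Component.connected (with_proj G)"

text \<open>
  The constant \<^const>\<open>tree\<close> is not usable for symmetric digraphs: there the two
  orientations of an edge already form a cycle. The cycles of the underlying undirected graph are
  the directed cycles with at least three arcs.
\<close>

definition tree_graph :: "'a pair_pre_digraph \<Rightarrow> bool" where
  "tree_graph G \<longleftrightarrow> connected_graph G \<and>
     \<not> (\<exists>p. pre_digraph.cycle (with_proj G) p \<and> length p \<ge> 3)"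

text \<open>
  With unit weights the cost of a walk is its length. The coercion \<^const>\<open>real_of_ereal\<close> sends
  the distance \<open>\<infinity>\<close> between vertices in different components to \<open>0\<close>, so
  the constants below are meaningful for connected graphs only.
\<close>

definition graph_dist :: "'a pair_pre_digraph \<Rightarrow> 'a \<Rightarrow> 'a \<Rightarrow> real" where
  "graph_dist G u v = real_of_ereal (wf_digraph.\<mu> (with_proj G) (\<lambda>_. 1) u v)"

text \<open>
  Vectors in \<open>\<real>\<^sup>V\<close> are functions \<open>'a \<Rightarrow> real\<close> of which only the values on the vertex set matter.
\<close>

definition vertex_inner :: "'a pair_pre_digraph \<Rightarrow> ('a \<Rightarrow> real) \<Rightarrow> ('a \<Rightarrow> real) \<Rightarrow> real" where
  "vertex_inner G f g = (\<Sum>v\<in>pverts G. f v * g v)"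

definition dist_matrix_mult :: "'a pair_pre_digraph \<Rightarrow> ('a \<Rightarrow> real) \<Rightarrow> 'a \<Rightarrow> real" where
  "dist_matrix_mult G f u = (\<Sum>v\<in>pverts G. graph_dist G u v * f v)"

text \<open>
  The greatest element (an attained maximum, not just a supremum). On fewer than two vertices no
  \<open>f\<close> satisfies the constraints and the value is unspecified.
\<close>

definition QEC :: "'a pair_pre_digraph \<Rightarrow> real" where
  "QEC G = (GREATEST r. \<exists>f. r = vertex_inner G f (dist_matrix_mult G f) \<and>
     vertex_inner G f f = 1 \<and> vertex_inner G (\<lambda>_. 1) f = 0)"

text \<open>
  The Euclidean space is \<open>\<real>\<^sup>N\<close> for some \<open>N\<close>, with points given by their first \<open>N\<close> coordinates;
  every Euclidean space is isometric to one of these.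
\<close>

definition QE_class :: "'a pair_pre_digraph \<Rightarrow> bool" where
  "QE_class G \<longleftrightarrow> connected_graph G \<and>
     (\<exists>(N::nat) (\<psi> :: 'a \<Rightarrow> nat \<Rightarrow> real). \<forall>i\<in>pverts G. \<forall>j\<in>pverts G.
        graph_dist G i j = (L2_set (\<lambda>k. \<psi> i k - \<psi> j k) {..<N})\<^sup>2)"

definition cartesian_product ::
  "'a pair_pre_digraph \<Rightarrow> 'b pair_pre_digraph \<Rightarrow> ('a \<times> 'b) pair_pre_digraph" where
  "cartesian_product G H =
     \<lparr> pverts = pverts G \<times> pverts H,
       parcs = {((u, v), (u', v')) | u v u' v'.
         (u, u') \<in> parcs G \<and> v \<in> pverts H \<and> v = v' \<or>
         u \<in> pverts G \<and> u = u' \<and> (v, v') \<in> parcs H} \<rparr>"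

end

theory Submission
  imports Defs "HOL-Analysis.Convex"
begin

text \<open>
  Distances in a Cartesian product are sums of distances in the factors. Hence the quadratic form
  \<open>\<langle>f, D f\<rangle>\<close> of \<open>K \<times> G\<close> splits as \<open>\<langle>a, D\<^sub>K a\<rangle> + \<langle>b, D\<^sub>G b\<rangle>\<close>, where \<open>a\<close> and \<open>b\<close> are the marginals
  of \<open>f\<close> on the two factors (\<open>dist_form_cartesian_product\<close>). Both marginals sum to zero with \<open>f\<close>.
  If \<open>G\<close> is of QE class, the second summand is at most zero. For the first, the
  Cauchy-Schwarz inequality over the \<open>l\<close> vertices of a fibre gives \<open>\<langle>a, a\<rangle> \<le> l \<langle>f, f\<rangle>\<close>, so a bound
  \<open>\<langle>a, D\<^sub>K a\<rangle> \<le> c \<langle>a, a\<rangle>\<close> with \<open>c \<ge> 0\<close> becomes the bound \<open>l c\<close> on the product. It is attained by the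
  functions that are constant along the fibres: for these \<open>b = 0\<close>, and Cauchy-Schwarz is an equality.
  Thus \<open>QEC (K \<times> G) = l c\<close> with \<open>c = QEC K\<close> (\<open>QEC_cartesian_product_QE_class\<close>).

  For the complete bipartite graph with parts \<open>U\<close> and \<open>V\<close> the form on sum-zero functions equals
  \<open>2 s\<^sup>2 - 2 \<langle>f, f\<rangle>\<close>, where \<open>s\<close> is the sum of \<open>f\<close> over \<open>U\<close> (\<open>complete_bipartite_dist_form\<close>). Cauchy-Schwarz
  on each part gives \<open>s\<^sup>2 (1/m + 1/n) \<le> \<langle>f, f\<rangle>\<close>, with equality when \<open>f\<close> is constant on each part; so
  \<open>c = 2 m n / (m + n) - 2\<close>. The hypotheses on \<open>m\<close> and \<open>n\<close> make this nonnegative.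

  Trees are of QE class (\<open>tree_graph_QE_class\<close>): root the tree and send each vertex to the indicator
  vector of its set of ancestors. Walking along an edge changes exactly one coordinate, and the
  graph distance is the number of coordinates in which two such vectors differ.
\<close>

section \<open>Distances from descent functions\<close>

text \<open>
  A function with these properties is the distance to \<open>w\<close>: it drops by at most one along every edge,
  so no walk is shorter, and away from \<open>w\<close> some edge drops it by exactly one, so some
  walk is as short. Every distance computed below is obtained by exhibiting such a function.
\<close>

definition hop_count_to :: "'a pair_pre_digraph \<Rightarrow> 'a \<Rightarrow> ('a \<Rightarrow> nat) \<Rightarrow> bool" where
  "hop_count_to G w h \<longleftrightarrow> w \<in> pverts G \<and> h w = 0 \<and>
     (\<forall>x y. (x, y) \<in> parcs G \<longrightarrow> h x \<le> Suc (h y)) \<and>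
     (\<forall>x\<in>pverts G. x \<noteq> w \<longrightarrow> (\<exists>y. (x, y) \<in> parcs G \<and> h x = Suc (h y)))"

lemma hop_count_to_eq_0_iff:
  assumes "hop_count_to G w h" "x \<in> pverts G"
  shows "h x = 0 \<longleftrightarrow> x = w"
  using assms unfolding hop_count_to_def by auto

context pair_wf_digraph
begin

lemma hop_count_le_length_awalk:
  assumes "hop_count_to G w h" "awalk x p w"
  shows "h x \<le> length p"
  using assms(2)
proof (induction p arbitrary: x)
  case Nil
  then show ?case using assms(1) by (auto simp: awalk_Nil_iff hop_count_to_def)
next
  case (Cons e p)
  then have e: "e \<in> parcs G" "x = fst e" "awalk (snd e) p w"
    by (auto simp: awalk_Cons_iff)
  then have "h x \<le> Suc (h (snd e))"
    using assms(1) unfolding hop_count_to_def by (metis prod.collapse)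
  with Cons.IH[OF e(3)] show ?case by simp
qed

lemma hop_count_awalk_exists:
  assumes "hop_count_to G w h" "x \<in> pverts G"
  shows "\<exists>p. awalk x p w \<and> length p = h x"
  using assms(2)
proof (induction "h x" arbitrary: x)
  case 0
  then have "x = w" using hop_count_to_eq_0_iff[OF assms(1)] by auto
  then show ?case using 0 by (auto simp: awalk_Nil_iff intro!: exI[of _ "[]"])
next
  case (Suc n)
  then have "x \<noteq> w" using hop_count_to_eq_0_iff[OF assms(1)] by force
  then obtain y where y: "(x, y) \<in> parcs G" "h x = Suc (h y)"
    using assms(1) Suc.prems unfolding hop_count_to_def by blast
  then obtain p where "awalk y p w" "length p = h y"
    using Suc.hyps in_arcsD2 by force
  with y show ?case by (auto simp: awalk_Cons_iff intro!: exI[of _ "(x, y) # p"])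
qed

lemma graph_dist_eq_hop_count:
  assumes "hop_count_to G w h" "x \<in> pverts G"
  shows "graph_dist G x w = h x"
proof -
  have cost: "awalk_cost (\<lambda>_. 1) p = real (length p)" for p :: "('a \<times> 'a) list"
    by (induction p) auto
  obtain p where p: "awalk x p w" "length p = h x"
    using hop_count_awalk_exists[OF assms] by blast
  have "\<mu> (\<lambda>_. 1) x w = ereal (h x)"
  proof (rule antisym)
    show "\<mu> (\<lambda>_. 1) x w \<le> ereal (h x)"
      using min_cost_le_walk_cost[OF p(1), of "\<lambda>_. 1"] p(2) by (simp add: cost)
    show "ereal (h x) \<le> \<mu> (\<lambda>_. 1) x w"
      unfolding \<mu>_def using hop_count_le_length_awalk[OF assms(1)]
      by (auto intro!: INF_greatest simp: cost)
  qed
  then show ?thesis by (simp add: graph_dist_def)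
qed

end

text \<open>
  The converse direction: in a connected graph the length of a shortest walk to \<open>w\<close> is such a function.
\<close>

lemma connected_graph_hop_count:
  assumes "connected_graph G" "w \<in> pverts G"
  obtains h where "hop_count_to G w h"
proof -
  interpret pair_graph G using assms(1) by (simp add: connected_graph_def)
  have "strongly_connected (with_proj G)"
    using assms(1) symmetric_connected_imp_strongly_connected pair_sym_arcs
    by (simp add: connected_graph_def)
  then have ex: "\<exists>n p. awalk x p w \<and> length p = n" if "x \<in> pverts G" for x
    using that assms(2) reachable_awalk unfolding strongly_connected_def by auto
  define h where "h x = (LEAST n. \<exists>p. awalk x p w \<and> length p = n)" for x
  have shortest: "\<exists>p. awalk x p w \<and> length p = h x" if "x \<in> pverts G" for x
    unfolding h_def by (rule LeastI_ex) (use ex[OF that] in blast)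
  have least: "h x \<le> length p" if "awalk x p w" for x p
    unfolding h_def by (rule Least_le) (use that in blast)
  have "h w = 0"
    using least[of w "[]"] assms(2) by (auto simp: awalk_Nil_iff)
  moreover have step: "h x \<le> Suc (h y)" if xy: "(x, y) \<in> parcs G" for x y
  proof -
    obtain p where "awalk y p w" "length p = h y"
      using shortest[OF in_arcsD2[OF xy]] by blast
    then show ?thesis
      using least[of x "(x, y) # p"] xy by (auto simp: awalk_Cons_iff)
  qed
  moreover have "\<exists>y. (x, y) \<in> parcs G \<and> h x = Suc (h y)"
    if x: "x \<in> pverts G" "x \<noteq> w" for x
  proof -
    obtain p where p: "awalk x p w" "length p = h x"
      using shortest[OF x(1)] by blast
    with x(2) obtain e q where [simp]: "p = e # q"
      by (cases p) (auto simp: awalk_Nil_iff)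
    have e: "(x, snd e) \<in> parcs G" "awalk (snd e) q w"
      using p(1) by (auto simp: awalk_Cons_iff)
    then have "h x = Suc (h (snd e))"
      using least[OF e(2)] step[OF e(1)] p(2) by simp
    with e show ?thesis by blast
  qed
  ultimately show ?thesis
    using assms(2) by (intro that[of h]) (auto simp: hop_count_to_def)
qed

lemma pair_wf_digraph_cartesian_product:
  assumes "pair_wf_digraph G" "pair_wf_digraph H"
  shows "pair_wf_digraph (cartesian_product G H)"
proof -
  interpret G: pair_wf_digraph G by fact
  interpret H: pair_wf_digraph H by fact
  show ?thesis
    by unfold_locales
      (auto simp: cartesian_product_def dest: G.wellformed' H.wellformed')
qed

text \<open>
  The sum of two descent functions descends on the product: as long as one coordinate differs from
  its target, some step in that coordinate decreases the sum by one.
\<close>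

lemma graph_dist_cartesian_product:
  assumes "connected_graph G" "connected_graph H"
    and "u \<in> pverts G" "u' \<in> pverts G" "v \<in> pverts H" "v' \<in> pverts H"
  shows "graph_dist (cartesian_product G H) (u, v) (u', v') = graph_dist G u u' + graph_dist H v v'"
proof -
  interpret G: pair_graph G using assms(1) by (simp add: connected_graph_def)
  interpret H: pair_graph H using assms(2) by (simp add: connected_graph_def)
  interpret P: pair_wf_digraph "cartesian_product G H"
    by (intro pair_wf_digraph_cartesian_product) unfold_locales
  obtain h where h: "hop_count_to G u' h"
    using connected_graph_hop_count assms(1,4) .
  obtain k where k: "hop_count_to H v' k"
    using connected_graph_hop_count assms(2,6) .
  have "hop_count_to (cartesian_product G H) (u', v') (\<lambda>(x, y). h x + k y)"
    unfolding hop_count_to_def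
  proof (intro conjI allI impI ballI)
    show "(u', v') \<in> pverts (cartesian_product G H)"
      using assms by (simp add: cartesian_product_def)
    show "(case (u', v') of (x, y) \<Rightarrow> h x + k y) = 0"
      using h k by (simp add: hop_count_to_def)
    fix x assume x: "x \<in> pverts (cartesian_product G H)" "x \<noteq> (u', v')"
    obtain a b where [simp]: "x = (a, b)" by force
    have ab: "a \<in> pverts G" "b \<in> pverts H"
      using x(1) by (auto simp: cartesian_product_def)
    show "\<exists>y. (x, y) \<in> parcs (cartesian_product G H) \<and>
        (case x of (x, y) \<Rightarrow> h x + k y) = Suc (case y of (x, y) \<Rightarrow> h x + k y)"
    proof (cases "a = u'")
      case True
      then have "b \<noteq> v'" using x(2) by simp
      then obtain b' where "(b, b') \<in> parcs H" "k b = Suc (k b')"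
        using k ab unfolding hop_count_to_def by blast
      then show ?thesis
        using ab by (intro exI[of _ "(a, b')"]) (simp add: cartesian_product_def)
    next
      case False
      then obtain a' where "(a, a') \<in> parcs G" "h a = Suc (h a')"
        using h ab unfolding hop_count_to_def by blast
      then show ?thesis
        using ab by (intro exI[of _ "(a', b)"]) (simp add: cartesian_product_def)
    qed
  next
    fix x y assume "(x, y) \<in> parcs (cartesian_product G H)"
    then show "(case x of (x, y) \<Rightarrow> h x + k y) \<le> Suc (case y of (x, y) \<Rightarrow> h x + k y)"
      using h k by (auto simp: cartesian_product_def hop_count_to_def)
  qed
  from P.graph_dist_eq_hop_count[OF this, of "(u, v)"] show ?thesis
    using assms G.graph_dist_eq_hop_count[OF h] H.graph_dist_eq_hop_count[OF k]
    by (simp add: cartesian_product_def)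
qed


section \<open>The quadratic form of a Cartesian product\<close>

abbreviation dist_form :: "'a pair_pre_digraph \<Rightarrow> ('a \<Rightarrow> real) \<Rightarrow> real" where
  "dist_form G f \<equiv> vertex_inner G f (dist_matrix_mult G f)"

lemma dist_form_eq_double_sum:
  "dist_form G f = (\<Sum>u\<in>pverts G. \<Sum>v\<in>pverts G. graph_dist G u v * (f u * f v))"
  by (simp add: vertex_inner_def dist_matrix_mult_def sum_distrib_left mult_ac)

text \<open>
  Numerator and denominator of the Rayleigh quotient are both homogeneous of degree two, so the
  maximum may be sought without normalising \<open>f\<close>.
\<close>

lemma QEC_eqI:
  assumes bound: "\<And>f. vertex_inner G (\<lambda>_. 1) f = 0 \<Longrightarrow> dist_form G f \<le> c * vertex_inner G f f"
    and g: "vertex_inner G (\<lambda>_. 1) g = 0" "vertex_inner G g g > 0"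
      "dist_form G g = c * vertex_inner G g g"
  shows "QEC G = c"
  unfolding QEC_def
proof (rule Greatest_equality)
  define s where "s = sqrt (vertex_inner G g g)"
  have s: "s * s = vertex_inner G g g" "s > 0"
    using g(2) by (auto simp: s_def)
  define f where "f v = g v / s" for v
  have "vertex_inner G f f = vertex_inner G g g / (s * s)"
    by (simp add: vertex_inner_def f_def sum_divide_distrib)
  moreover have "vertex_inner G (\<lambda>_. 1) f = vertex_inner G (\<lambda>_. 1) g / s"
    by (simp add: vertex_inner_def f_def sum_divide_distrib)
  moreover have "dist_form G f = dist_form G g / (s * s)"
    by (simp add: dist_form_eq_double_sum f_def sum_divide_distrib)
  ultimately show "\<exists>f. c = dist_form G f \<and> vertex_inner G f f = 1 \<and> vertex_inner G (\<lambda>_. 1) f = 0"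
    using s g by (intro exI[of _ f]) auto
next
  fix r
  assume "\<exists>f. r = dist_form G f \<and> vertex_inner G f f = 1 \<and> vertex_inner G (\<lambda>_. 1) f = 0"
  then show "r \<le> c" using bound by fastforce
qed

text \<open>
  This is the easy direction of Schoenberg's theorem: since \<open>f\<close> sums to zero, only the cross term
  survives when \<open>(x i - x j)\<^sup>2\<close> is expanded, and each coordinate \<open>x\<close> of the embedding contributes
  \<open>-2 (\<Sum> x i f i)\<^sup>2\<close>.
\<close>

lemma QE_class_dist_form_nonpos:
  assumes "QE_class G" "vertex_inner G (\<lambda>_. 1) f = 0"
  shows "dist_form G f \<le> 0"
proof -
  obtain N :: nat and \<psi> where dist: "\<And>i j. i \<in> pverts G \<Longrightarrow> j \<in> pverts G \<Longrightarrow>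
        graph_dist G i j = (L2_set (\<lambda>k. \<psi> i k - \<psi> j k) {..<N})\<^sup>2"
    using assms(1) unfolding QE_class_def by blast
  let ?V = "pverts G"
  have f0: "(\<Sum>v\<in>?V. f v) = 0" using assms(2) by (simp add: vertex_inner_def)
  have coord: "(\<Sum>i\<in>?V. \<Sum>j\<in>?V. (x i - x j)\<^sup>2 * (f i * f j)) = - 2 * (\<Sum>i\<in>?V. x i * f i)\<^sup>2"
    for x :: "'a \<Rightarrow> real"
  proof -
    have "(\<Sum>i\<in>?V. \<Sum>j\<in>?V. (x i - x j)\<^sup>2 * (f i * f j)) =
        (\<Sum>i\<in>?V. \<Sum>j\<in>?V. ((x i)\<^sup>2 * f i) * f j + f i * ((x j)\<^sup>2 * f j)
          - 2 * ((x i * f i) * (x j * f j)))"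
      by (intro sum.cong refl) (simp add: algebra_simps power2_eq_square)
    also have "\<dots> = (\<Sum>i\<in>?V. (x i)\<^sup>2 * f i) * (\<Sum>j\<in>?V. f j)
        + (\<Sum>i\<in>?V. f i) * (\<Sum>j\<in>?V. (x j)\<^sup>2 * f j)
        - 2 * ((\<Sum>i\<in>?V. x i * f i) * (\<Sum>j\<in>?V. x j * f j))"
      unfolding sum_product sum_subtractf sum.distrib by (simp only: sum_distrib_left)
    finally show ?thesis using f0 by (simp add: power2_eq_square)
  qed
  have "dist_form G f = (\<Sum>i\<in>?V. \<Sum>j\<in>?V. \<Sum>k<N. (\<psi> i k - \<psi> j k)\<^sup>2 * (f i * f j))"
    unfolding dist_form_eq_double_sum
    by (intro sum.cong refl) (simp add: dist L2_set_def sum_nonneg sum_distrib_right)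
  also have "\<dots> = (\<Sum>i\<in>?V. \<Sum>k<N. \<Sum>j\<in>?V. (\<psi> i k - \<psi> j k)\<^sup>2 * (f i * f j))"
    by (intro sum.cong refl sum.swap)
  also have "\<dots> = (\<Sum>k<N. \<Sum>i\<in>?V. \<Sum>j\<in>?V. (\<psi> i k - \<psi> j k)\<^sup>2 * (f i * f j))"
    by (rule sum.swap)
  also have "\<dots> = (\<Sum>k<N. - 2 * (\<Sum>i\<in>?V. \<psi> i k * f i)\<^sup>2)"
    by (intro sum.cong refl coord)
  also have "\<dots> \<le> 0" by (intro sum_nonpos) simp
  finally show ?thesis .
qed

text \<open>
  Each factor's distance ignores the other coordinate, so that summing over the other coordinate
  leaves only the marginals of \<open>f\<close>.
\<close>

lemma dist_form_cartesian_product: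
  assumes "connected_graph G" "connected_graph H"
  shows "dist_form (cartesian_product G H) f =
    dist_form G (\<lambda>u. \<Sum>v\<in>pverts H. f (u, v)) + dist_form H (\<lambda>v. \<Sum>u\<in>pverts G. f (u, v))"
proof -
  let ?V = "pverts G" and ?W = "pverts H"
  have pverts: "pverts (cartesian_product G H) = ?V \<times> ?W"
    by (simp add: cartesian_product_def)
  have "dist_form (cartesian_product G H) f =
    (\<Sum>u\<in>?V. \<Sum>v\<in>?W. \<Sum>u'\<in>?V. \<Sum>v'\<in>?W.
      graph_dist (cartesian_product G H) (u, v) (u', v') * (f (u, v) * f (u', v')))"
    unfolding dist_form_eq_double_sum
    by (simp add: pverts sum.cartesian_product')
  also have "\<dots> = (\<Sum>u\<in>?V. \<Sum>v\<in>?W. \<Sum>u'\<in>?V. \<Sum>v'\<in>?W.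
        graph_dist G u u' * (f (u, v) * f (u', v')) + graph_dist H v v' * (f (u, v) * f (u', v')))"
    using assms by (intro sum.cong refl) (simp add: graph_dist_cartesian_product algebra_simps)
  also have "\<dots> = (\<Sum>u\<in>?V. \<Sum>v\<in>?W. \<Sum>u'\<in>?V. \<Sum>v'\<in>?W. graph_dist G u u' * (f (u, v) * f (u', v')))
      + (\<Sum>u\<in>?V. \<Sum>v\<in>?W. \<Sum>u'\<in>?V. \<Sum>v'\<in>?W. graph_dist H v v' * (f (u, v) * f (u', v')))"
    by (simp only: sum.distrib)
  also have "(\<Sum>u\<in>?V. \<Sum>v\<in>?W. \<Sum>u'\<in>?V. \<Sum>v'\<in>?W. graph_dist G u u' * (f (u, v) * f (u', v')))
      = dist_form G (\<lambda>u. \<Sum>v\<in>?W. f (u, v))"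
    unfolding dist_form_eq_double_sum sum_product unfolding sum_distrib_left
    by (intro sum.cong refl sum.swap)
  also have "(\<Sum>u\<in>?V. \<Sum>v\<in>?W. \<Sum>u'\<in>?V. \<Sum>v'\<in>?W. graph_dist H v v' * (f (u, v) * f (u', v')))
      = (\<Sum>v\<in>?W. \<Sum>u\<in>?V. \<Sum>v'\<in>?W. \<Sum>u'\<in>?V. graph_dist H v v' * (f (u, v) * f (u', v')))"
    by (subst sum.swap) (intro sum.cong refl sum.swap)
  also have "\<dots> = dist_form H (\<lambda>v. \<Sum>u\<in>?V. f (u, v))"
    unfolding dist_form_eq_double_sum sum_product unfolding sum_distrib_left
    by (intro sum.cong refl sum.swap)
  finally show ?thesis .
qed

text \<open>
  The bound and the witness \<open>g\<close> say that \<open>c\<close> is the quadratic embedding constant of \<open>G\<close>. The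
  sign condition on \<open>c\<close> is what allows \<open>\<langle>a, a\<rangle>\<close> to be replaced by its upper bound.
\<close>

theorem QEC_cartesian_product_QE_class:
  fixes c :: real
  assumes G: "connected_graph G" and H: "QE_class H" and "c \<ge> 0"
    and bound: "\<And>f. vertex_inner G (\<lambda>_. 1) f = 0 \<Longrightarrow> dist_form G f \<le> c * vertex_inner G f f"
    and g: "vertex_inner G (\<lambda>_. 1) g = 0" "vertex_inner G g g > 0"
      "dist_form G g = c * vertex_inner G g g"
  shows "QEC (cartesian_product G H) = card (pverts H) * c"
proof (rule QEC_eqI)
  let ?V = "pverts G" and ?W = "pverts H" and ?P = "cartesian_product G H"
  have conn: "connected_graph H" using H by (simp add: QE_class_def)
  have inner: "vertex_inner ?P f f' = (\<Sum>u\<in>?V. \<Sum>v\<in>?W. f (u, v) * f' (u, v))" for f f'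
    by (simp add: vertex_inner_def cartesian_product_def sum.cartesian_product split_def)
  have "finite ?W"
    using conn pair_fin_digraph.pair_finite_verts
    by (auto simp: connected_graph_def pair_graph_def pair_digraph_def)
  moreover have "?W \<noteq> {}"
    using conn by (auto simp: connected_graph_def connected_conv)
  ultimately have l: "card ?W > 0" by (simp add: card_gt_0_iff)
  show "dist_form ?P f \<le> card ?W * c * vertex_inner ?P f f"
    if f: "vertex_inner ?P (\<lambda>_. 1) f = 0" for f
  proof -
    define a where "a u = (\<Sum>v\<in>?W. f (u, v))" for u
    define b where "b v = (\<Sum>u\<in>?V. f (u, v))" for v
    have a0: "vertex_inner G (\<lambda>_. 1) a = 0"
      using f unfolding inner by (simp add: vertex_inner_def a_def)
    have b0: "vertex_inner H (\<lambda>_. 1) b = 0"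
      using f unfolding inner by (subst (asm) sum.swap) (simp add: vertex_inner_def b_def)
    have aa: "(a u)\<^sup>2 \<le> card ?W * (\<Sum>v\<in>?W. (f (u, v))\<^sup>2)" for u
      using sum_squared_le_sum_of_squares[of "\<lambda>v. f (u, v)" ?W] by (simp add: a_def mult.commute)
    have "dist_form ?P f = dist_form G a + dist_form H b"
      unfolding a_def b_def by (rule dist_form_cartesian_product[OF G conn])
    also have "\<dots> \<le> c * vertex_inner G a a"
      using bound[OF a0] QE_class_dist_form_nonpos[OF H b0] by simp
    finally have le: "dist_form ?P f \<le> c * vertex_inner G a a" .
    have "vertex_inner G a a \<le> (\<Sum>u\<in>?V. card ?W * (\<Sum>v\<in>?W. (f (u, v))\<^sup>2))"
      unfolding vertex_inner_def by (intro sum_mono) (use aa in \<open>simp add: power2_eq_square\<close>)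
    also have "\<dots> = card ?W * vertex_inner ?P f f"
      unfolding inner by (simp add: sum_distrib_left power2_eq_square)
    finally have "c * vertex_inner G a a \<le> c * (card ?W * vertex_inner ?P f f)"
      using \<open>c \<ge> 0\<close> by (rule mult_left_mono)
    with le show ?thesis by (simp add: mult_ac)
  qed
  \<comment> \<open>The extremal function: \<open>g\<close> spread evenly over the fibres, whose second marginal vanishes.\<close>
  let ?g = "\<lambda>(u, v). g u"
  have norm: "vertex_inner ?P ?g ?g = card ?W * vertex_inner G g g"
    unfolding inner by (simp add: vertex_inner_def sum_distrib_left)
  show "vertex_inner ?P ?g ?g > 0" unfolding norm using l g(2) by simp
  have g0: "(\<Sum>u\<in>?V. g u) = 0" using g(1) by (simp add: vertex_inner_def)
  show "vertex_inner ?P (\<lambda>_. 1) ?g = 0"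
    unfolding inner using g0 by (simp add: sum_distrib_left[symmetric])
  have "dist_form ?P ?g = dist_form G (\<lambda>u. card ?W * g u) + dist_form H (\<lambda>v. 0)"
    using dist_form_cartesian_product[OF G conn, of ?g] g0 by simp
  also have "\<dots> = (card ?W)\<^sup>2 * dist_form G g"
    unfolding dist_form_eq_double_sum
    by (simp add: sum_distrib_left power2_eq_square mult_ac)
  finally show "dist_form ?P ?g = card ?W * c * vertex_inner ?P ?g ?g"
    unfolding norm g(3) by (simp add: power2_eq_square)
qed


section \<open>Complete bipartite graphs\<close>

text \<open>
  Up to the diagonal, the distance is 2 inside a part and 1 across. As \<open>f\<close> sums to \<open>s\<close> on \<open>U\<close> and to \<open>-s\<close>
  on \<open>V\<close>, row \<open>x\<close> of \<open>D f\<close> is \<open>2s - s\<close> or \<open>-2s + s\<close>, corrected by \<open>-2 f x\<close> for the zero on the diagonal.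
\<close>

lemma complete_bipartite_dist_form:
  assumes UV: "pverts K = U \<union> V" "U \<inter> V = {}" "finite U" "finite V" "U \<noteq> {}" "V \<noteq> {}"
    "parcs K = U \<times> V \<union> V \<times> U"
    and f: "vertex_inner K (\<lambda>_. 1) f = 0"
  shows "dist_form K f = 2 * (\<Sum>u\<in>U. f u)\<^sup>2 - 2 * vertex_inner K f f"
    and "(\<Sum>v\<in>V. f v) = - (\<Sum>u\<in>U. f u)"
proof -
  interpret pair_wf_digraph K
    by unfold_locales (auto simp: UV(1,7))
  have dist: "graph_dist K x w = (if x = w then 0 else if x \<in> U \<longleftrightarrow> w \<in> U then 2 else 1)"
    if "x \<in> pverts K" "w \<in> pverts K" for x w
  proof -
    let ?h = "\<lambda>x. if x = w then 0 else if x \<in> U \<longleftrightarrow> w \<in> U then 2 else 1 :: nat"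
    obtain u v where uv: "u \<in> U" "v \<in> V" using UV(5,6) by blast
    have "\<exists>y. (x, y) \<in> parcs K \<and> ?h x = Suc (?h y)" if x: "x \<in> pverts K" "x \<noteq> w" for x
    proof (cases "x \<in> U \<longleftrightarrow> w \<in> U")
      case True
      then have "(x, if x \<in> U then v else u) \<in> parcs K"
        using x UV(1,7) uv by auto
      then show ?thesis using True x UV(2) uv
        by (intro exI[of _ "if x \<in> U then v else u"]) auto
    next
      case False
      then have "(x, w) \<in> parcs K"
        using x \<open>w \<in> pverts K\<close> UV(1,7) by auto
      then show ?thesis using False x by (intro exI[of _ w]) auto
    qed
    moreover have "?h x \<le> Suc (?h y)" if "(x, y) \<in> parcs K" for x y
    proof -
      have "x \<in> U \<longleftrightarrow> y \<notin> U" using that UV(2,7) by blast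
      then show ?thesis by auto
    qed
    ultimately have "hop_count_to K w ?h"
      unfolding hop_count_to_def using that(2) by simp
    from graph_dist_eq_hop_count[OF this that(1)] show ?thesis by simp
  qed
  have split: "(\<Sum>x\<in>pverts K. g x) = (\<Sum>x\<in>U. g x) + (\<Sum>x\<in>V. g x)" for g :: "'a \<Rightarrow> real"
    unfolding UV(1) by (intro sum.union_disjoint UV)
  define s where "s = (\<Sum>u\<in>U. f u)"
  show sV: "(\<Sum>v\<in>V. f v) = - (\<Sum>u\<in>U. f u)"
    using f by (simp add: vertex_inner_def split)
  have row: "dist_matrix_mult K f x = (if x \<in> U then s else - s) - 2 * f x"
    if x: "x \<in> pverts K" for x
  proof -
    have "dist_matrix_mult K f x = (\<Sum>w\<in>pverts K. (if x \<in> U \<longleftrightarrow> w \<in> U then 2 else 1) * f w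
        - (if w = x then 2 * f x else 0))"
      unfolding dist_matrix_mult_def by (intro sum.cong refl) (auto simp: dist x)
    also have "\<dots> = (\<Sum>w\<in>pverts K. (if x \<in> U \<longleftrightarrow> w \<in> U then 2 else 1) * f w) - 2 * f x"
      using x UV by (simp add: sum_subtractf)
    also have "(\<Sum>w\<in>pverts K. (if x \<in> U \<longleftrightarrow> w \<in> U then 2 else 1) * f w)
       = (\<Sum>w\<in>U. (if x \<in> U then 2 else 1) * f w) + (\<Sum>w\<in>V. (if x \<in> U then 1 else 2) * f w)"
      unfolding split using UV(2) by (intro arg_cong2[of _ _ _ _ "(+)"] sum.cong) auto
    also have "\<dots> = (if x \<in> U then s else - s)"
      unfolding sum_distrib_left[symmetric] sV by (simp add: s_def)
    finally show ?thesis .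
  qed
  have "dist_form K f = (\<Sum>x\<in>pverts K. (if x \<in> U then s else - s) * f x) - 2 * vertex_inner K f f"
    unfolding vertex_inner_def
    by (simp add: row algebra_simps sum_subtractf sum_distrib_left)
  also have "(\<Sum>x\<in>pverts K. (if x \<in> U then s else - s) * f x)
      = (\<Sum>x\<in>U. s * f x) + (\<Sum>x\<in>V. - s * f x)"
    unfolding split using UV(2) by (intro arg_cong2[of _ _ _ _ "(+)"] sum.cong) auto
  also have "\<dots> = 2 * s\<^sup>2"
    unfolding sum_distrib_left[symmetric] sV by (simp add: s_def power2_eq_square)
  finally show "dist_form K f = 2 * (\<Sum>u\<in>U. f u)\<^sup>2 - 2 * vertex_inner K f f"
    by (simp add: s_def)
qed

lemma complete_bipartite_connected_graph:
  assumes "complete_bipartite_digraph m n (with_proj K)" "m > 0" "n > 0"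
  shows "connected_graph K"
proof -
  interpret pair_graph K using assms(1) by (rule pair_graphI_complete_bipartite)
  obtain U V where UV: "pverts K = U \<union> V" "card U = m" "card V = n"
      "parcs K = U \<times> V \<union> V \<times> U"
    using assms(1) unfolding complete_bipartite_digraph_pair_def by blast
  then obtain u v where uv: "u \<in> U" "v \<in> V"
    using assms(2,3) by (metis card.empty ex_in_conv less_irrefl)
  have arc: "x \<rightarrow>\<^sup>*\<^bsub>with_proj K\<^esub> y" if "(x, y) \<in> parcs K" for x y
    using that by (intro reachable_adjI) auto
  have "x \<rightarrow>\<^sup>*\<^bsub>with_proj K\<^esub> u \<and> u \<rightarrow>\<^sup>*\<^bsub>with_proj K\<^esub> x" if x: "x \<in> pverts K" for x
  proof (cases "x \<in> V")
    case True
    then show ?thesis using UV uv arc by blast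
  next
    case False
    then have "(x, v) \<in> parcs K" "(v, u) \<in> parcs K" "(u, v) \<in> parcs K" "(v, x) \<in> parcs K"
      using x UV uv by auto
    then show ?thesis using arc reachable_trans by blast
  qed
  then have "x \<rightarrow>\<^sup>*\<^bsub>with_proj K\<^esub> y" if "x \<in> pverts K" "y \<in> pverts K" for x y
    using that reachable_trans by blast
  moreover have "u \<in> pverts K" using uv UV(1) by blast
  ultimately have "strongly_connected (with_proj K)"
    unfolding strongly_connected_def by auto
  then show ?thesis
    unfolding connected_graph_def
    using reachable_mk_symmetricI pair_graph_axioms
    by (auto simp: strongly_connected_def Digraph_Component.connected_def)
qed

text \<open>
  The bound for \<open>K\<close> is Cauchy-Schwarz on each part, and the weights \<open>n\<close> on the part of size \<open>m\<close> and \<open>-m\<close>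
  on the part of size \<open>n\<close> attain it, being constant on parts and of total sum zero.
\<close>

lemma QEC_cartesian_product_complete_bipartite:
  assumes K: "complete_bipartite_digraph m n (with_proj K)"
    and m: "m \<ge> 3" and n: "n \<ge> 2" and H: "QE_class H"
  shows "QEC (cartesian_product K H) =
    card (pverts H) * ((real n * (real m - 2) + real m * (real n - 2)) / (real m + real n))"
proof -
  obtain U V where UV: "pverts K = U \<union> V" "U \<inter> V = {}" "card U = m" "card V = n"
      "parcs K = U \<times> V \<union> V \<times> U"
    using K unfolding complete_bipartite_digraph_pair_def by blast
  have "card U > 0" "card V > 0" using UV(3,4) m n by auto
  then have fin: "finite U" "finite V" "U \<noteq> {}" "V \<noteq> {}"
    by (auto simp: card_gt_0_iff)
  note form = complete_bipartite_dist_form[OF UV(1,2) fin UV(5)]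
  have split: "(\<Sum>x\<in>pverts K. g x) = (\<Sum>x\<in>U. g x) + (\<Sum>x\<in>V. g x)" for g :: "'a \<Rightarrow> real"
    unfolding UV(1) by (intro sum.union_disjoint UV fin)
  have mn: "real m > 0" "real n > 0" using m n by auto
  define c where "c = (real n * (real m - 2) + real m * (real n - 2)) / (real m + real n)"
  \<comment> \<open>The constant is \<open>2 m n / (m + n) - 2\<close>, and \<open>c + 2\<close> is the sharp factor for \<open>2 s\<^sup>2\<close>.\<close>
  have c: "(c + 2) * (real m + real n) = 2 * real m * real n"
    using mn by (simp add: c_def field_simps)
  have "c \<ge> 0" unfolding c_def using m n by simp
  have bound: "dist_form K f \<le> c * vertex_inner K f f" if f: "vertex_inner K (\<lambda>_. 1) f = 0" for f
  proof -
    define s where "s = (\<Sum>u\<in>U. f u)"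
    have "s\<^sup>2 \<le> real m * (\<Sum>u\<in>U. (f u)\<^sup>2)"
      using sum_squared_le_sum_of_squares[of f U] UV by (simp add: s_def mult.commute)
    then have 1: "real n * s\<^sup>2 \<le> real n * (real m * (\<Sum>u\<in>U. (f u)\<^sup>2))"
      by (intro mult_left_mono) auto
    have "s\<^sup>2 \<le> real n * (\<Sum>v\<in>V. (f v)\<^sup>2)"
      using sum_squared_le_sum_of_squares[of f V] UV form(2)[OF f] by (simp add: s_def mult.commute)
    then have 2: "real m * s\<^sup>2 \<le> real m * (real n * (\<Sum>v\<in>V. (f v)\<^sup>2))"
      by (intro mult_left_mono) auto
    have "(real m + real n) * (2 * s\<^sup>2) \<le> 2 * real m * real n * vertex_inner K f f"
      using 1 2 by (simp add: vertex_inner_def split power2_eq_square[symmetric] algebra_simps)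
    also have "\<dots> = (real m + real n) * ((c + 2) * vertex_inner K f f)"
      unfolding c[symmetric] by simp
    finally have "2 * s\<^sup>2 \<le> (c + 2) * vertex_inner K f f"
      using mn by simp
    then show ?thesis using form(1)[OF f] by (simp add: s_def algebra_simps)
  qed
  define g where "g x = (if x \<in> U then real n else - real m)" for x
  have gU: "(\<Sum>x\<in>U. g x) = real m * real n" by (simp add: g_def UV)
  have "(\<Sum>x\<in>V. g x) = (\<Sum>x\<in>V. - real m)"
    using UV(2) by (intro sum.cong) (auto simp: g_def)
  then have g0: "vertex_inner K (\<lambda>_. 1) g = 0"
    using gU by (simp add: vertex_inner_def split UV(4))
  have "(\<Sum>x\<in>V. g x * g x) = (\<Sum>x\<in>V. real m * real m)"
    using UV(2) by (intro sum.cong) (auto simp: g_def)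
  then have gg: "vertex_inner K g g = real m * real n * (real m + real n)"
    by (simp add: vertex_inner_def split UV(4)) (simp add: g_def UV(3) algebra_simps)
  have "dist_form K g = c * vertex_inner K g g"
  proof -
    have "2 * (real m * real n)\<^sup>2 = (c + 2) * vertex_inner K g g"
      unfolding gg using c by (simp add: power2_eq_square mult_ac)
    then show ?thesis using form(1)[OF g0] gU by (simp add: algebra_simps)
  qed
  then show ?thesis
    using QEC_cartesian_product_QE_class[OF _ H \<open>c \<ge> 0\<close> bound g0]
      complete_bipartite_connected_graph[OF K] mn gg by (simp add: c_def)
qed


section \<open>Trees are of QE class\<close>

text \<open>
  After its start, a shortest walk from \<open>a\<close> or from \<open>b\<close> to \<open>r\<close> only visits vertices closer to \<open>r\<close> than its
  starting point, hence never \<open>v\<close>. So \<open>a\<close> and \<open>b\<close> are joined by a path that avoids \<open>v\<close>, and \<open>v\<close> closes it to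
  a cycle. In a tree this makes the neighbour of \<open>v\<close> on the way to the root unique, and rules out edges
  between vertices of equal depth.
\<close>

lemma cycle_if_two_lower_neighbours:
  assumes "pair_graph G" and h: "hop_count_to G r h"
    and arcs: "(v, a) \<in> parcs G" "(v, b) \<in> parcs G" "a \<noteq> b"
    and le: "h a \<le> h v" "h b \<le> h v"
  shows "\<exists>p. pre_digraph.cycle (with_proj G) p \<and> length p \<ge> 3"
proof -
  interpret pair_graph G by fact
  have flip: "(y, x) \<in> parcs G" if "(x, y) \<in> parcs G" for x y
    using arcs_ends_symmetric[OF pair_sym_arcs, of x y] that by simp
  \<comment> \<open>The edges of the graph after deletion of \<open>v\<close>.\<close>
  define A where "A = {(x, y) \<in> parcs G. x \<noteq> v \<and> y \<noteq> v}"
  have "sym A" unfolding A_def by (auto intro!: symI flip)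
  have to_root: "(x, r) \<in> A\<^sup>*" if "x \<in> pverts G" "x \<noteq> v" "h x \<le> h v" for x
    using that
  proof (induction "h x" arbitrary: x rule: less_induct)
    case less
    show ?case
    proof (cases "x = r")
      case False
      then obtain y where y: "(x, y) \<in> parcs G" "h x = Suc (h y)"
        using h less.prems unfolding hop_count_to_def by blast
      then have "y \<noteq> v" using less.prems by auto
      moreover have "(y, r) \<in> A\<^sup>*"
        using less y \<open>y \<noteq> v\<close> in_arcsD2 by force
      ultimately show ?thesis using y less.prems
        by (auto simp: A_def intro: converse_rtrancl_into_rtrancl)
    qed simp
  qed
  have ab: "a \<in> pverts G" "b \<in> pverts G" "a \<noteq> v" "b \<noteq> v"
    using arcs in_arcsD2 pair_no_loops by force+
  then have "(a, r) \<in> A\<^sup>*" "(r, b) \<in> A\<^sup>*"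
    using to_root le sym_rtrancl[OF \<open>sym A\<close>] by (auto dest: symD)
  then have "(a, b) \<in> A\<^sup>*" by (rule rtrancl_trans)
  then have "\<exists>p. awalk a p b \<and> set p \<subseteq> A"
  proof (induction rule: converse_rtrancl_induct)
    case base
    then show ?case using ab by (auto simp: awalk_Nil_iff intro!: exI[of _ "[]"])
  next
    case (step x y)
    then obtain p where "awalk y p b" "set p \<subseteq> A" by blast
    with step(1) show ?case
      by (intro exI[of _ "(x, y) # p"]) (auto simp: awalk_Cons_iff A_def)
  qed
  then obtain p where p: "awalk a p b" "set p \<subseteq> A" by blast
  define q where "q = awalk_to_apath p"
  have q: "apath a q b" "set q \<subseteq> A"
    unfolding q_def using p apath_awalk_to_apath awalk_to_apath_subset by (blast, blast)
  have aq: "awalk a q b" "distinct (pawalk_verts a q)"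
    using q(1) by (auto simp: apath_def)
  have "v \<notin> set (pawalk_verts a q)"
    using set_awalk_verts[OF aq(1)] q(2) ab by (auto simp: A_def)
  moreover have "q \<noteq> []" using aq(1) arcs(3) by (auto simp: awalk_Nil_iff)
  moreover have "pawalk_verts a (q @ [(b, v)]) = pawalk_verts a q @ [v]"
  proof -
    have "awalk a (q @ [(b, v)]) v"
      using aq(1) arcs(2) flip in_arcsD1 by (intro awalk_appendI) (auto simp: awalk_simps)
    from awalk_verts_append[OF this] show ?thesis by simp
  qed
  moreover have "awalk v ((v, a) # q @ [(b, v)]) v"
    using aq(1) arcs flip in_arcsD1 awalk_appendI[of a q b "[(b, v)]" v]
    by (auto simp: awalk_simps)
  ultimately have "cycle ((v, a) # q @ [(b, v)])"
    unfolding cycle_def using aq(2) by (auto intro!: exI[of _ v])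
  moreover have "length ((v, a) # q @ [(b, v)]) \<ge> 3"
    using \<open>q \<noteq> []\<close> by (cases q) auto
  ultimately show ?thesis by blast
qed

text \<open>
  Indicator vectors turn the size of a symmetric difference into a squared Euclidean distance.
\<close>

lemma QE_class_if_symmetric_difference_dist:
  assumes "connected_graph G" and P: "\<And>v. v \<in> pverts G \<Longrightarrow> P v \<subseteq> pverts G"
    and dist: "\<And>u v. u \<in> pverts G \<Longrightarrow> v \<in> pverts G \<Longrightarrow>
      graph_dist G u v = card ((P u - P v) \<union> (P v - P u))"
  shows "QE_class G"
proof -
  interpret pair_graph G using assms(1) by (simp add: connected_graph_def)
  obtain e where e: "bij_betw e {..<card (pverts G)} (pverts G)"
    using ex_bij_betw_nat_finite[OF pair_finite_verts] by (auto simp: lessThan_atLeast0)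
  define \<psi> where "\<psi> v k = (if e k \<in> P v then 1 else 0 :: real)" for v k
  have "graph_dist G u v = (L2_set (\<lambda>k. \<psi> u k - \<psi> v k) {..<card (pverts G)})\<^sup>2"
    if uv: "u \<in> pverts G" "v \<in> pverts G" for u v
  proof -
    let ?D = "(P u - P v) \<union> (P v - P u)"
    have "(L2_set (\<lambda>k. \<psi> u k - \<psi> v k) {..<card (pverts G)})\<^sup>2
        = (\<Sum>k<card (pverts G). (\<psi> u k - \<psi> v k)\<^sup>2)"
      by (simp add: L2_set_def sum_nonneg)
    also have "\<dots> = (\<Sum>k<card (pverts G). if e k \<in> ?D then 1 else 0)"
      by (intro sum.cong) (auto simp: \<psi>_def)
    also have "\<dots> = (\<Sum>z\<in>pverts G. if z \<in> ?D then 1 else 0)"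
      by (rule sum.reindex_bij_betw[OF e])
    also have "\<dots> = card (pverts G \<inter> ?D)"
      using pair_finite_verts by (subst sum.inter_restrict[symmetric]) auto
    also have "pverts G \<inter> ?D = ?D" using P uv by blast
    finally show ?thesis using dist uv by simp
  qed
  with assms(1) show ?thesis unfolding QE_class_def by blast
qed

text \<open>
  With \<open>P v\<close> the set of ancestors of \<open>v\<close>, including \<open>v\<close> itself, the sets of the two ends of an edge
  differ by the child end only. The size of the symmetric difference of \<open>P x\<close> and \<open>P w\<close> is therefore a
  descent function towards \<open>w\<close>: from an ancestor \<open>x \<noteq> w\<close> of \<open>w\<close> one moves to its child on the branch of
  \<open>w\<close>, from any other \<open>x\<close> to its parent.
\<close>

lemma tree_graph_QE_class:
  assumes "tree_graph G"
  shows "QE_class G"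
proof -
  have conn: "connected_graph G" and
    acyclic: "\<not> (\<exists>p. pre_digraph.cycle (with_proj G) p \<and> length p \<ge> 3)"
    using assms by (auto simp: tree_graph_def)
  interpret pair_graph G using conn by (simp add: connected_graph_def)
  obtain r where r: "r \<in> pverts G"
    using conn by (auto simp: connected_graph_def connected_conv)
  obtain h where h: "hop_count_to G r h"
    using connected_graph_hop_count[OF conn r] .
  note lower_unique = cycle_if_two_lower_neighbours[OF pair_graph_axioms h]
  \<comment> \<open>\<open>R\<close> relates a vertex to its parent with respect to the root \<open>r\<close>.\<close>
  define R where "R = {(v, p) \<in> parcs G. h v = Suc (h p)}"
  have parent: "\<exists>p. (v, p) \<in> R" if "v \<in> pverts G" "v \<noteq> r" for v
    using that h unfolding hop_count_to_def R_def by auto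
  have R_unique: "p = q" if "(v, p) \<in> R" "(v, q) \<in> R" for v p q
    using lower_unique[of v p q] acyclic that by (auto simp: R_def)
  have flip: "(y, x) \<in> parcs G" if "(x, y) \<in> parcs G" for x y
    using arcs_ends_symmetric[OF pair_sym_arcs, of x y] that by simp
  have arc_cases: "(x, y) \<in> R \<or> (y, x) \<in> R" if xy: "(x, y) \<in> parcs G" for x y
  proof -
    have "h x \<noteq> h y"
    proof
      assume eq: "h x = h y"
      have "x \<noteq> r"
      proof
        assume "x = r"
        then have "y = r"
          using eq h hop_count_to_eq_0_iff[OF h] xy in_arcsD1 in_arcsD2 by metis
        then show False using \<open>x = r\<close> xy pair_no_loops by force
      qed
      then obtain p where p: "(x, p) \<in> R" using parent xy in_arcsD1 by blast
      then have "p \<noteq> y" using eq by (auto simp: R_def)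
      with p show False
        using lower_unique[of x p y] acyclic xy eq by (auto simp: R_def)
    qed
    moreover have "h x \<le> Suc (h y)" "h y \<le> Suc (h x)"
      using h xy flip unfolding hop_count_to_def by auto
    ultimately show ?thesis using xy flip by (auto simp: R_def)
  qed
  define P where "P v = {z. (v, z) \<in> R\<^sup>*}" for v
  have P_self: "v \<in> P v" for v by (simp add: P_def)
  have P_le: "h z \<le> h v" if "z \<in> P v" for z v
    using that unfolding P_def mem_Collect_eq
    by (induction rule: rtrancl_induct) (auto simp: R_def)
  have P_sub: "P v \<subseteq> pverts G" if "v \<in> pverts G" for v
  proof
    fix z assume "z \<in> P v"
    then have "(v, z) \<in> R\<^sup>*" by (simp add: P_def)
    then show "z \<in> pverts G"
      using that by (induction rule: rtrancl_induct) (auto simp: R_def in_arcsD2)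
  qed
  have P_parent: "P v = insert v (P p)" "v \<notin> P p" if "(v, p) \<in> R" for v p
  proof -
    show "P v = insert v (P p)"
      unfolding P_def
      by (auto intro: converse_rtrancl_into_rtrancl that dest: R_unique[OF that] elim: converse_rtranclE)
    show "v \<notin> P p" using P_le[of v p] that by (auto simp: R_def)
  qed
  have P_root: "r \<in> P v" if "v \<in> pverts G" for v
    using that
  proof (induction "h v" arbitrary: v rule: less_induct)
    case less
    show ?case
    proof (cases "v = r")
      case False
      then obtain p where p: "(v, p) \<in> R" using parent less.prems by blast
      then have "r \<in> P p" using less by (auto simp: R_def in_arcsD2)
      then show ?thesis using P_parent(1)[OF p] by simp
    qed (simp add: P_self)
  qed
  have finP: "finite (P v)" if "v \<in> pverts G" for v
    using P_sub[OF that] pair_finite_verts finite_subset by blast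
  have dist: "graph_dist G x w = card ((P x - P w) \<union> (P w - P x))"
    if x: "x \<in> pverts G" and w: "w \<in> pverts G" for x w
  proof -
    define k where "k x = card ((P x - P w) \<union> (P w - P x))" for x
    have fin: "finite ((P y - P w) \<union> (P w - P y))" if "y \<in> pverts G" for y
      using finP w that by auto
    \<comment> \<open>Going to the parent removes \<open>v\<close> from the difference if \<open>v\<close> is no ancestor of \<open>w\<close>, else adds it.\<close>
    have up: "k v = Suc (k p)" if "(v, p) \<in> R" "v \<notin> P w" for v p
    proof -
      have "(P v - P w) \<union> (P w - P v) = insert v ((P p - P w) \<union> (P w - P p))"
        unfolding P_parent(1)[OF that(1)] using P_parent(2)[OF that(1)] that(2) by blast
      moreover have "v \<notin> (P p - P w) \<union> (P w - P p)"
        unfolding P_parent(1)[OF that(1)] using P_parent(2)[OF that(1)] that(2) by blast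
      moreover have "p \<in> pverts G" using that(1) by (auto simp: R_def in_arcsD2)
      ultimately show ?thesis
        unfolding k_def using fin[of p] by (metis card_insert_disjoint)
    qed
    have down: "k p = Suc (k v)" if "(v, p) \<in> R" "v \<in> P w" for v p
    proof -
      have "(P p - P w) \<union> (P w - P p) = insert v ((P v - P w) \<union> (P w - P v))"
        unfolding P_parent(1)[OF that(1)] using P_parent(2)[OF that(1)] that(2) by blast
      moreover have "v \<notin> (P v - P w) \<union> (P w - P v)"
        unfolding P_parent(1)[OF that(1)] using P_parent(2)[OF that(1)] that(2) by blast
      moreover have "v \<in> pverts G" using that(1) by (auto simp: R_def in_arcsD1)
      ultimately show ?thesis
        unfolding k_def using fin[of v] by (metis card_insert_disjoint)
    qed
    have "hop_count_to G w k"
      unfolding hop_count_to_def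
    proof (intro conjI allI impI ballI)
      show "w \<in> pverts G" by fact
      show "k w = 0" by (simp add: k_def)
      show "k x \<le> Suc (k y)" if "(x, y) \<in> parcs G" for x y
        using arc_cases[OF that] up down by (metis le_SucI order_refl)
      show "\<exists>y. (x, y) \<in> parcs G \<and> k x = Suc (k y)" if x: "x \<in> pverts G" "x \<noteq> w" for x
      proof (cases "x \<in> P w")
        case True
        then obtain y where "(w, y) \<in> R\<^sup>*" "(y, x) \<in> R"
          using x(2) by (auto simp: P_def elim: rtranclE)
        then show ?thesis using down[of y x] flip by (auto simp: P_def R_def)
      next
        case False
        then have "x \<noteq> r" using P_root[OF w] by auto
        then obtain y where "(x, y) \<in> R" using parent x(1) by blast
        then show ?thesis using up[of x y] False by (auto simp: R_def)
      qed
    qed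
    from graph_dist_eq_hop_count[OF this x] show ?thesis by (simp add: k_def)
  qed
  show ?thesis
    using conn P_sub dist by (rule QE_class_if_symmetric_difference_dist)
qed


section \<open>The product formula\<close>

theorem corollary1p6:
  fixes m n :: nat and K :: "'a pair_pre_digraph"
  assumes "m \<ge> 3" and "n \<ge> 2"
    and "complete_bipartite_digraph m n (with_proj K)"
  shows "(\<forall>(G :: 'b pair_pre_digraph) (l::nat).
            connected_graph G \<and> QE_class G \<and> card (pverts G) = l \<longrightarrow>
            QEC (cartesian_product K G) =
              real l * ((real n * (real m - 2) + real m * (real n - 2)) / (real m + real n))) \<and>
         (\<forall>(T :: 'b pair_pre_digraph) (l::nat).
            tree_graph T \<and> card (pverts T) = l \<longrightarrow>
            QEC (cartesian_product K T) =
              real l * ((real n * (real m - 2) + real m * (real n - 2)) / (real m + real n)))"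
  using QEC_cartesian_product_complete_bipartite[OF assms(3,1,2)] tree_graph_QE_class by blast

end
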